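(* For every graph $G$ on $n$ vertices and every real $k$ with $1\le k\le n$, $$\alpha_k'(G)\leq\vartheta_k(G).$$
   Context: Graphs are finite and simple with nonempty vertex set $V$; $A_G$ is the adjacency matrix. For a graph $H$ with vertex set $V(H)$, let $\mathcal{S}(H)$ be the set of nonempty cocliques (independent sets) of $H$; the fractional chromatic number is $$\chi_f(H)=\min\Big\{\sum_{S\in\mathcal{S}(H)}y_S : y\in\mathbb{R}_+^{\mathcal{S}(H)},\ \sum_{S\in\mathcal{S}(H)}y_S\mathbf{1}_S=\mathbf{1}\Big\},$$ where $\mathbf{1}_S\in\{0,1\}^{V(H)}$ is the incidence vector of $S$ and $\mathbf{1}$ the all-ones vector. For real $k\geq1$, $\alpha_k'(G)$ is the largest number of vertices in an induced subgraph of $G$ whose fractional chromatic number is at most $k$. For real $k\in[1,n]$, $$\vartheta_k(G)=\max\{\langle J,X\rangle : X\text{ real symmetric }V\times V,\ \langle I,X\rangle=k,\ A_G\circ X=0,\ 0\preceq X\preceq I\},$$ where $I$ is the identity, $J$ the all-ones matrix, $\circ$ the entrywise product, $\langle A,B\rangle=\operatorname{trace}(AB)$, and $A\preceq B$ means $B-A$ is positive semidefinite. *)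

theory Defs
  imports "HOL-Analysis.Analysis"
begin

text \<open>
  A graph has the whole finite type as its vertex set and is given by its adjacency relation.
  Subgraphs induced on a set \<open>W\<close> are represented by the pair of \<open>W\<close> and the same relation,
  of which only the restriction to \<open>W\<close> matters.
\<close>

definition simple_graph :: "('v \<Rightarrow> 'v \<Rightarrow> bool) \<Rightarrow> bool" where
  "simple_graph E \<longleftrightarrow> symp E \<and> irreflp E"

definition cocliques :: "('v \<Rightarrow> 'v \<Rightarrow> bool) \<Rightarrow> 'v set \<Rightarrow> 'v set set" where
  "cocliques E W = {S. S \<subseteq> W \<and> S \<noteq> {} \<and> (\<forall>u\<in>S. \<forall>v\<in>S. \<not> E u v)}"

text \<open>Values of \<open>y\<close> outside the cocliques of the induced subgraph are irrelevant.\<close>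

definition fractional_colouring ::
    "('v \<Rightarrow> 'v \<Rightarrow> bool) \<Rightarrow> 'v set \<Rightarrow> ('v set \<Rightarrow> real) \<Rightarrow> bool" where
  "fractional_colouring E W y \<longleftrightarrow>
     (\<forall>S \<in> cocliques E W. 0 \<le> y S) \<and>
     (\<forall>v \<in> W. (\<Sum>S \<in> cocliques E W. y S * indicator S v) = 1)"

text \<open>
  \<open>LEAST\<close> and \<open>GREATEST\<close> on the reals denote an attained minimum and maximum; that these exist is
  shown below.
\<close>

definition fractional_chromatic_number :: "('v \<Rightarrow> 'v \<Rightarrow> bool) \<Rightarrow> 'v set \<Rightarrow> real" where
  "fractional_chromatic_number E W =
     (LEAST r. \<exists>y. fractional_colouring E W y \<and> r = (\<Sum>S \<in> cocliques E W. y S))"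

definition alpha' :: "('v::finite \<Rightarrow> 'v \<Rightarrow> bool) \<Rightarrow> real \<Rightarrow> nat" where
  "alpha' E k = Max {card W | W. W \<noteq> {} \<and> fractional_chromatic_number E W \<le> k}"

definition adjacency_matrix :: "('v::finite \<Rightarrow> 'v \<Rightarrow> bool) \<Rightarrow> real^'v^'v" where
  "adjacency_matrix E = (\<chi> i j. if E i j then 1 else 0)"

definition all_ones_matrix :: "real^'v^'v" where
  "all_ones_matrix = (\<chi> i j. 1)"

definition entrywise_product :: "real^'v^'v \<Rightarrow> real^'v^'v \<Rightarrow> real^'v^'v" where
  "entrywise_product A B = (\<chi> i j. A $ i $ j * B $ i $ j)"

definition trace_inner :: "real^'v^'v \<Rightarrow> real^'v^'v \<Rightarrow> real" where
  "trace_inner A B = trace (A ** B)"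

definition pos_semidef :: "real^'v^'v \<Rightarrow> bool" where
  "pos_semidef A \<longleftrightarrow> transpose A = A \<and> (\<forall>x. 0 \<le> x \<bullet> (A *v x))"

definition loewner_le :: "real^'v^'v \<Rightarrow> real^'v^'v \<Rightarrow> bool" where
  "loewner_le A B \<longleftrightarrow> pos_semidef (B - A)"

definition theta_feasible :: "('v::finite \<Rightarrow> 'v \<Rightarrow> bool) \<Rightarrow> real \<Rightarrow> (real^'v^'v) set" where
  "theta_feasible E k =
     {X. transpose X = X \<and> trace_inner (mat 1) X = k \<and>
         entrywise_product (adjacency_matrix E) X = 0 \<and>
         loewner_le 0 X \<and> loewner_le X (mat 1)}"

definition theta :: "('v::finite \<Rightarrow> 'v \<Rightarrow> bool) \<Rightarrow> real \<Rightarrow> real" where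
  "theta E k = (GREATEST r. \<exists>X \<in> theta_feasible E k. r = trace_inner all_ones_matrix X)"

lemma fractional_chromatic_number_attained:
  fixes E :: "'v::finite \<Rightarrow> 'v \<Rightarrow> bool"
  assumes irr: "irreflp E"
  shows "\<exists>y. fractional_colouring E W y \<and>
             (\<Sum>S \<in> cocliques E W. y S) = fractional_chromatic_number E W \<and>
             (\<forall>z. fractional_colouring E W z \<longrightarrow>
                  fractional_chromatic_number E W \<le> (\<Sum>S \<in> cocliques E W. z S))"
proof -
  let ?C = "cocliques E W"
  let ?F = "{y :: real^('v set). fractional_colouring E W (($) y) \<and> (\<forall>S. S \<notin> ?C \<longrightarrow> y $ S = 0)}"
  let ?f = "\<lambda>y :: real^('v set). \<Sum>S \<in> ?C. y $ S"
  have bnd: "\<bar>y $ S\<bar> \<le> 1" if y: "y \<in> ?F" for y S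
  proof (cases "S \<in> ?C")
    case True
    then obtain v where v: "v \<in> S" "v \<in> W" by (auto simp: cocliques_def)
    have nn: "\<And>S. S \<in> ?C \<Longrightarrow> 0 \<le> y $ S" using y by (simp add: fractional_colouring_def)
    have "y $ S = y $ S * indicator S v" using v by simp
    also have "\<dots> \<le> (\<Sum>S \<in> ?C. y $ S * indicator S v)"
      by (rule member_le_sum) (use True nn in auto)
    also have "\<dots> = 1" using y v by (simp add: fractional_colouring_def)
    finally show ?thesis using nn True by auto
  next
    case False
    then show ?thesis using y by simp
  qed
  have "?F \<subseteq> cbox (\<chi> S. -1) (\<chi> S. 1)"
    using bnd by (auto simp: mem_box_cart abs_le_iff minus_le_iff)
  then have "bounded ?F" by (rule bounded_subset[OF bounded_cbox])
  moreover have "closed ?F"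
    unfolding fractional_colouring_def Ball_def
    by (intro closed_Collect_conj closed_Collect_all closed_Collect_imp open_Collect_const
        closed_Collect_le closed_Collect_eq continuous_intros)
  ultimately have "compact ?F" by (simp add: compact_eq_bounded_closed)
  moreover have "?F \<noteq> {}"
  proof -
    let ?y = "(\<chi> S. if S \<in> ?C \<and> card S = 1 then 1 else 0) :: real^('v set)"
    have "(\<Sum>S \<in> ?C. ?y $ S * indicator S v) = 1" if v: "v \<in> W" for v
    proof -
      have vC: "{v} \<in> ?C" using v irr by (auto simp: cocliques_def irreflp_def)
      have "(\<Sum>S \<in> ?C. ?y $ S * indicator S v) = (\<Sum>S \<in> {{v}}. ?y $ S * indicator S v)"
        by (rule sum.mono_neutral_right) (use vC in \<open>auto simp: card_1_singleton_iff indicator_def\<close>)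
      then show ?thesis using vC by simp
    qed
    then have "?y \<in> ?F" by (simp add: fractional_colouring_def)
    then show ?thesis by blast
  qed
  moreover have "continuous_on ?F ?f" by (intro continuous_intros)
  ultimately obtain y where y: "y \<in> ?F" and ymin: "\<forall>z\<in>?F. ?f y \<le> ?f z"
    using continuous_attains_inf[of ?F ?f] by blast
  have min: "?f y \<le> (\<Sum>S \<in> ?C. z S)" if z: "fractional_colouring E W z" for z
  proof -
    let ?z = "(\<chi> S. if S \<in> ?C then z S else 0) :: real^('v set)"
    have "?z \<in> ?F" using z by (simp add: fractional_colouring_def)
    then have "?f y \<le> ?f ?z" using ymin by blast
    also have "?f ?z = (\<Sum>S \<in> ?C. z S)" by (rule sum.cong) auto
    finally show ?thesis .
  qed
  have "fractional_chromatic_number E W = ?f y"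
    unfolding fractional_chromatic_number_def
    by (rule Least_equality) (use y min in auto)
  then show ?thesis using y min by (intro exI[of _ "($) y"]) auto
qed

lemma theta_attained:
  fixes E :: "'v::finite \<Rightarrow> 'v \<Rightarrow> bool"
  assumes irr: "irreflp E" and k: "0 \<le> k" "k \<le> real CARD('v)"
  shows "\<exists>X \<in> theta_feasible E k. trace_inner all_ones_matrix X = theta E k \<and>
             (\<forall>Y \<in> theta_feasible E k. trace_inner all_ones_matrix Y \<le> theta E k)"
proof -
  let ?F = "theta_feasible E k"
  let ?f = "\<lambda>X :: real^'v^'v. trace_inner all_ones_matrix X"
  have entry: "axis i 1 \<bullet> (M *v axis j 1) = M $ i $ j" for M :: "real^'v^'v" and i j
    by (simp add: inner_axis' matrix_vector_mult_basis column_def)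
  have bnd: "\<bar>X $ i $ j\<bar> \<le> 1" if X: "X \<in> ?F" for X i j
  proof -
    have psd: "0 \<le> x \<bullet> (X *v x)" and psd': "0 \<le> x \<bullet> ((mat 1 - X) *v x)" for x
      using X by (simp_all add: theta_feasible_def loewner_le_def pos_semidef_def)
    have "transpose X = X" using X by (simp add: theta_feasible_def)
    then have sym: "X $ j $ i = X $ i $ j" by (metis transpose_def vec_lambda_beta)
    have d: "X $ a $ a \<le> 1" for a
      using psd'[of "axis a 1"] by (simp add: entry mat_def)
    have "0 \<le> X $ i $ i + X $ j $ j + 2 * X $ i $ j"
      using psd[of "axis i 1 + axis j 1"] sym
      by (simp add: matrix_vector_right_distrib inner_add_left inner_add_right entry)
    moreover have "0 \<le> X $ i $ i + X $ j $ j - 2 * X $ i $ j"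
      using psd[of "axis i 1 - axis j 1"] sym
      by (simp add: matrix_vector_mult_diff_distrib inner_diff_left inner_diff_right entry)
    ultimately show ?thesis using d[of i] d[of j] by linarith
  qed
  have "norm X \<le> (\<Sum>i\<in>(UNIV::'v set). \<Sum>j\<in>(UNIV::'v set). 1)" if X: "X \<in> ?F" for X
  proof -
    have "norm X \<le> (\<Sum>i\<in>UNIV. norm (X $ i))"
      unfolding norm_vec_def by (rule L2_set_le_sum) simp
    also have "\<dots> \<le> (\<Sum>i\<in>UNIV. \<Sum>j\<in>UNIV. \<bar>X $ i $ j\<bar>)"
      by (intro sum_mono norm_le_l1_cart)
    also have "\<dots> \<le> (\<Sum>i\<in>(UNIV::'v set). \<Sum>j\<in>(UNIV::'v set). 1)"
      by (intro sum_mono bnd X)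
    finally show ?thesis .
  qed
  then have "bounded ?F" unfolding bounded_iff by blast
  moreover have "closed ?F"
    unfolding theta_feasible_def loewner_le_def pos_semidef_def trace_inner_def trace_def
      entrywise_product_def vec_eq_iff transpose_def matrix_matrix_mult_def
      matrix_vector_mult_def inner_vec_def inner_real_def vec_lambda_beta vector_minus_component
    by (intro closed_Collect_conj closed_Collect_all
        closed_Collect_le closed_Collect_eq continuous_intros)
  ultimately have "compact ?F" by (simp add: compact_eq_bounded_closed)
  moreover have "?F \<noteq> {}"
  proof -
    let ?c = "k / real CARD('v)"
    let ?X = "mat ?c :: real^'v^'v"
    have c: "0 \<le> ?c" "?c \<le> 1" using k by simp_all
    have mat_mult: "(mat d :: real^'v^'v) *v x = d *\<^sub>R x" for d x
      by (simp add: vec_eq_iff matrix_vector_mult_def mat_def if_distrib[of "\<lambda>a. a * _"] cong: if_cong)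
    have tr: "transpose ?X = ?X" by (simp add: transpose_mat)
    have diff: "mat 1 - ?X = mat (1 - ?c)" by (simp add: vec_eq_iff mat_def)
    have "trace_inner (mat 1) ?X = k" by (simp add: trace_inner_def trace_def mat_def matrix_mul_lid[unfolded mat_def])
    moreover have "entrywise_product (adjacency_matrix E) ?X = 0"
      using irr by (auto simp: entrywise_product_def adjacency_matrix_def vec_eq_iff mat_def irreflp_def)
    moreover have "loewner_le 0 ?X" "loewner_le ?X (mat 1)"
      using c by (simp_all add: loewner_le_def pos_semidef_def diff transpose_mat mat_mult del: times_divide_eq_left)
    ultimately have "?X \<in> ?F" using tr by (simp add: theta_feasible_def)
    then show ?thesis by blast
  qed
  moreover have "continuous_on ?F ?f"
    unfolding trace_inner_def trace_def matrix_matrix_mult_def vec_lambda_beta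
    by (intro continuous_intros)
  ultimately obtain X where X: "X \<in> ?F" and max: "\<forall>Y\<in>?F. ?f Y \<le> ?f X"
    using continuous_attains_sup[of ?F ?f] by blast
  have "theta E k = ?f X"
    unfolding theta_def by (rule Greatest_equality) (use X max in auto)
  then show ?thesis using X max by auto
qed

end

theory Submission
  imports Defs
begin

text \<open>
  Let \<open>W\<close> induce a subgraph of fractional chromatic number \<open>r \<le> k\<close>, and let \<open>y\<close> be an optimal
  fractional colouring, of total weight \<open>r\<close>. The matrix
  \<open>X = (\<Sum>S. (y S / card S) 1\<^sub>S 1\<^sub>S\<^sup>T)\<close>, a weighted sum of the orthogonal projections onto the lines
  spanned by the \<open>1\<^sub>S\<close>, is feasible for parameter \<open>r\<close> and has objective value \<open>card W\<close>:
  it vanishes on edges because every \<open>S\<close> is a coclique; each projection has trace \<open>1\<close>, so the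
  trace is the total weight \<open>r\<close>; the entries of the projection onto \<open>1\<^sub>S\<close> add up to \<open>card S\<close>, and
  \<open>\<Sum>S. y S * card S = card W\<close> since every vertex of \<open>W\<close> is covered with total weight \<open>1\<close>.
  Positive semidefiniteness is clear, and \<open>X \<preceq> I\<close> is the Cauchy--Schwarz inequality
  \<open>(\<Sum>v\<in>S. x v)\<^sup>2 / card S \<le> (\<Sum>v\<in>S. (x v)\<^sup>2)\<close> summed against \<open>y\<close>.

  The trace \<open>r\<close> may be smaller than \<open>k\<close>. Moving from \<open>X\<close> towards the identity along a segment
  keeps all other constraints, raises the trace continuously up to \<open>n\<close>, and does not lower the
  objective, because \<open>X \<preceq> I\<close> tested on the all-ones vector bounds the objective of \<open>X\<close> by that of
  the identity.
\<close>

section \<open>Quadratic forms\<close>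

lemma trace_inner_mat_1: "trace_inner (mat 1) X = (\<Sum>i\<in>UNIV. X $ i $ i)"
  by (simp add: trace_inner_def trace_def)

lemma quadratic_form_eq:
  fixes X :: "real^'v::finite^'v"
  shows "x \<bullet> (X *v x) = (\<Sum>i\<in>UNIV. \<Sum>j\<in>UNIV. X $ i $ j * x $ i * x $ j)"
  by (simp add: inner_vec_def matrix_vector_mult_def sum_distrib_left mult_ac)

lemma trace_inner_all_ones_eq_quadratic_form:
  fixes X :: "real^'v::finite^'v"
  shows "trace_inner all_ones_matrix X = 1 \<bullet> (X *v 1)"
proof -
  have "trace_inner all_ones_matrix X = (\<Sum>i\<in>UNIV. \<Sum>j\<in>UNIV. X $ j $ i)"
    by (simp add: trace_inner_def trace_def all_ones_matrix_def matrix_matrix_mult_def)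
  also have "\<dots> = (\<Sum>i\<in>UNIV. \<Sum>j\<in>UNIV. X $ i $ j)"
    by (rule sum.swap)
  finally show ?thesis
    by (simp add: quadratic_form_eq)
qed

lemma theta_feasible_iff:
  "X \<in> theta_feasible E k \<longleftrightarrow>
     transpose X = X \<and> (\<Sum>i\<in>UNIV. X $ i $ i) = k \<and> (\<forall>i j. E i j \<longrightarrow> X $ i $ j = 0) \<and>
     (\<forall>x. 0 \<le> x \<bullet> (X *v x)) \<and> (\<forall>x. x \<bullet> (X *v x) \<le> x \<bullet> x)"
proof -
  have edges: "entrywise_product (adjacency_matrix E) X = 0 \<longleftrightarrow> (\<forall>i j. E i j \<longrightarrow> X $ i $ j = 0)"
    by (auto simp: entrywise_product_def adjacency_matrix_def vec_eq_iff)
  have diff: "transpose (mat 1 - X) = mat 1 - X" if "transpose X = X"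
    using that by (simp add: transpose_def vec_eq_iff mat_def eq_commute[where ?'a='v])
  show ?thesis
    unfolding theta_feasible_def loewner_le_def pos_semidef_def trace_inner_mat_1
    by (auto simp: diff edges matrix_vector_mult_diff_rdistrib inner_diff_right)
qed

section \<open>Raising the trace\<close>

text \<open>
  The point \<open>(1 - t) X + t I\<close> of the segment from \<open>X\<close> to the identity has trace
  \<open>(1 - t) r + t n\<close>, so the value of \<open>t\<close> is forced; irreflexivity makes the identity vanish on
  edges.
\<close>

lemma theta_feasible_raise_trace:
  fixes E :: "'v::finite \<Rightarrow> 'v \<Rightarrow> bool"
  assumes irr: "irreflp E" and X: "X \<in> theta_feasible E r"
    and rk: "r \<le> k" and kn: "k \<le> real CARD('v)"
  shows "\<exists>Y \<in> theta_feasible E k.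
           trace_inner all_ones_matrix X \<le> trace_inner all_ones_matrix Y"
proof -
  let ?n = "real CARD('v)"
  \<comment> \<open>If \<open>r = n\<close> then \<open>k = n\<close> as well, and \<open>t = 0 / 0 = 0\<close> leaves \<open>X\<close> as it is.\<close>
  define t where "t = (k - r) / (?n - r)"
  have t: "0 \<le> t" "t \<le> 1"
    using rk kn by (auto simp: t_def divide_le_eq_1)
  have tr: "(1 - t) * r + t * ?n = k"
  proof -
    have "t * (?n - r) = k - r"
      using rk kn by (auto simp: t_def)
    then show ?thesis by (simp add: algebra_simps)
  qed
  define Y :: "real^'v^'v" where "Y = (1 - t) *\<^sub>R X + t *\<^sub>R mat 1"
  have form: "x \<bullet> (Y *v x) = (1 - t) * (x \<bullet> (X *v x)) + t * (x \<bullet> x)" for x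
    by (simp add: Y_def matrix_vector_mult_add_rdistrib scaleR_matrix_vector_assoc[symmetric]
        inner_add_right)
  note Xf = X[unfolded theta_feasible_iff]
  have psd: "0 \<le> x \<bullet> (X *v x)" and le: "x \<bullet> (X *v x) \<le> x \<bullet> x" for x
    using Xf by auto
  have "transpose Y = Y"
    using Xf by (simp add: Y_def transpose_def vec_eq_iff mat_def eq_commute[where ?'a='v])
  moreover have "(\<Sum>i\<in>UNIV. Y $ i $ i) = k"
    using Xf tr by (simp add: Y_def mat_def sum.distrib flip: sum_distrib_left) (simp add: mult.commute)
  moreover have "\<forall>i j. E i j \<longrightarrow> Y $ i $ j = 0"
    using Xf irr by (auto simp: Y_def mat_def irreflp_def)
  moreover have "0 \<le> x \<bullet> (Y *v x)" for x
    unfolding form using t psd[of x] by simp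
  moreover have "x \<bullet> (Y *v x) \<le> x \<bullet> x" for x
    using mult_left_mono[OF le[of x], of "1 - t"] t unfolding form by (simp add: algebra_simps)
  ultimately have "Y \<in> theta_feasible E k"
    by (simp add: theta_feasible_iff)
  moreover have "trace_inner all_ones_matrix X \<le> trace_inner all_ones_matrix Y"
    using mult_left_mono[OF le[of 1], of t] t
    unfolding trace_inner_all_ones_eq_quadratic_form form by (simp add: algebra_simps)
  ultimately show ?thesis by blast
qed

section \<open>The matrix of a fractional colouring\<close>

definition colouring_matrix ::
    "('v::finite \<Rightarrow> 'v \<Rightarrow> bool) \<Rightarrow> 'v set \<Rightarrow> ('v set \<Rightarrow> real) \<Rightarrow> real^'v^'v" where
  "colouring_matrix E W y =
     (\<chi> i j. \<Sum>S\<in>cocliques E W. y S / real (card S) * (indicator S i * indicator S j))"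

lemma coclique_card_pos:
  fixes S :: "'v::finite set"
  shows "S \<in> cocliques E W \<Longrightarrow> 0 < real (card S)"
  by (auto simp: cocliques_def card_gt_0_iff)

lemma sum_indicator_mult:
  fixes f :: "'v::finite \<Rightarrow> real"
  shows "(\<Sum>i\<in>UNIV. indicator S i * f i) = (\<Sum>i\<in>S. f i)"
  by (simp add: indicator_def if_distrib[of "\<lambda>a. a * _"] sum.If_cases cong: if_cong)

lemma colouring_matrix_quadratic_form:
  fixes E :: "'v::finite \<Rightarrow> 'v \<Rightarrow> bool"
  shows "x \<bullet> (colouring_matrix E W y *v x) =
           (\<Sum>S\<in>cocliques E W. y S / real (card S) * (\<Sum>v\<in>S. x $ v)\<^sup>2)"
proof -
  let ?c = "\<lambda>S. y S / real (card S)"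
  have "x \<bullet> (colouring_matrix E W y *v x) =
          (\<Sum>i\<in>UNIV. \<Sum>j\<in>UNIV. \<Sum>S\<in>cocliques E W.
             ?c S * ((indicator S i * x $ i) * (indicator S j * x $ j)))"
    unfolding quadratic_form_eq colouring_matrix_def
    by (simp add: sum_distrib_right sum_distrib_left mult_ac)
  also have "\<dots> = (\<Sum>i\<in>UNIV. \<Sum>S\<in>cocliques E W. \<Sum>j\<in>UNIV.
             ?c S * ((indicator S i * x $ i) * (indicator S j * x $ j)))"
    by (intro sum.cong refl sum.swap)
  also have "\<dots> = (\<Sum>S\<in>cocliques E W. \<Sum>i\<in>UNIV. \<Sum>j\<in>UNIV.
             ?c S * ((indicator S i * x $ i) * (indicator S j * x $ j)))"
    by (rule sum.swap)
  also have "\<dots> = (\<Sum>S\<in>cocliques E W. ?c S *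
             ((\<Sum>i\<in>UNIV. indicator S i * x $ i) * (\<Sum>j\<in>UNIV. indicator S j * x $ j)))"
    by (simp only: sum_product) (simp only: sum_distrib_left)
  finally show ?thesis
    by (simp only: sum_indicator_mult power2_eq_square)
qed

text \<open>Double counting: each vertex of \<open>W\<close> is covered with total weight \<open>1\<close>.\<close>

lemma fractional_colouring_weighted_sum:
  fixes E :: "'v::finite \<Rightarrow> 'v \<Rightarrow> bool" and f :: "'v \<Rightarrow> real"
  assumes "fractional_colouring E W y"
  shows "(\<Sum>S\<in>cocliques E W. y S * (\<Sum>v\<in>S. f v)) = (\<Sum>v\<in>W. f v)"
proof -
  have "(\<Sum>S\<in>cocliques E W. y S * (\<Sum>v\<in>S. f v)) =
          (\<Sum>S\<in>cocliques E W. \<Sum>v\<in>W. y S * indicator S v * f v)"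
  proof (rule sum.cong[OF refl])
    fix S assume "S \<in> cocliques E W"
    then have "S \<subseteq> W" by (simp add: cocliques_def)
    then have "(\<Sum>v\<in>S. f v) = (\<Sum>v\<in>W. indicator S v * f v)"
      by (intro sum.mono_neutral_cong_left) (auto simp: indicator_def)
    then show "y S * (\<Sum>v\<in>S. f v) = (\<Sum>v\<in>W. y S * indicator S v * f v)"
      by (simp only: sum_distrib_left mult.assoc)
  qed
  also have "\<dots> = (\<Sum>v\<in>W. (\<Sum>S\<in>cocliques E W. y S * indicator S v) * f v)"
    by (subst sum.swap) (simp only: sum_distrib_right)
  also have "\<dots> = (\<Sum>v\<in>W. f v)"
    using assms by (simp add: fractional_colouring_def)
  finally show ?thesis .
qed

lemma colouring_matrix_feasible:
  fixes E :: "'v::finite \<Rightarrow> 'v \<Rightarrow> bool"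
  assumes y: "fractional_colouring E W y"
  shows "colouring_matrix E W y \<in> theta_feasible E (\<Sum>S\<in>cocliques E W. y S)"
proof -
  let ?C = "cocliques E W" and ?X = "colouring_matrix E W y"
  have y0: "0 \<le> y S" if "S \<in> ?C" for S
    using y that by (simp add: fractional_colouring_def)
  have "transpose ?X = ?X"
    by (simp add: colouring_matrix_def transpose_def vec_eq_iff mult.commute)
  moreover have "(\<Sum>i\<in>UNIV. ?X $ i $ i) = (\<Sum>S\<in>?C. y S)"
  proof -
    have "(\<Sum>i\<in>UNIV. ?X $ i $ i) =
            (\<Sum>S\<in>?C. \<Sum>i\<in>UNIV. y S / real (card S) * (indicator S i * indicator S i))"
      unfolding colouring_matrix_def by (simp, rule sum.swap)
    also have "\<dots> = (\<Sum>S\<in>?C. y S / real (card S) * real (card S))"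
      by (simp only: sum_indicator_mult flip: sum_distrib_left) simp
    also have "\<dots> = (\<Sum>S\<in>?C. y S)"
      by (intro sum.cong refl) (use coclique_card_pos in fastforce)
    finally show ?thesis .
  qed
  moreover have "?X $ i $ j = 0" if "E i j" for i j
    unfolding colouring_matrix_def
    using that by (auto simp: cocliques_def indicator_def intro!: sum.neutral)
  moreover have "0 \<le> x \<bullet> (?X *v x)" for x
    unfolding colouring_matrix_quadratic_form by (intro sum_nonneg) (simp add: y0)
  moreover have "x \<bullet> (?X *v x) \<le> x \<bullet> x" for x
  proof -
    have "x \<bullet> (?X *v x) \<le> (\<Sum>S\<in>?C. y S * (\<Sum>v\<in>S. (x $ v)\<^sup>2))"
      unfolding colouring_matrix_quadratic_form
    proof (rule sum_mono)
      fix S assume S: "S \<in> ?C"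
      have "(\<Sum>v\<in>S. x $ v)\<^sup>2 \<le> (\<Sum>v\<in>S. (x $ v)\<^sup>2) * real (card S)"
        using Cauchy_Schwarz_ineq_sum[of "\<lambda>v. x $ v" "\<lambda>_. 1" S] by simp
      then have "(\<Sum>v\<in>S. x $ v)\<^sup>2 / real (card S) \<le> (\<Sum>v\<in>S. (x $ v)\<^sup>2)"
        using coclique_card_pos[OF S] by (simp add: pos_divide_le_eq)
      from mult_left_mono[OF this y0[OF S]]
      show "y S / real (card S) * (\<Sum>v\<in>S. x $ v)\<^sup>2 \<le> y S * (\<Sum>v\<in>S. (x $ v)\<^sup>2)"
        by simp
    qed
    also have "\<dots> = (\<Sum>v\<in>W. (x $ v)\<^sup>2)"
      by (rule fractional_colouring_weighted_sum[OF y])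
    also have "\<dots> \<le> (\<Sum>v\<in>UNIV. (x $ v)\<^sup>2)"
      by (intro sum_mono2) auto
    finally show ?thesis
      by (simp add: inner_vec_def power2_eq_square)
  qed
  ultimately show ?thesis
    by (simp add: theta_feasible_iff)
qed

lemma colouring_matrix_objective:
  fixes E :: "'v::finite \<Rightarrow> 'v \<Rightarrow> bool"
  assumes y: "fractional_colouring E W y"
  shows "trace_inner all_ones_matrix (colouring_matrix E W y) = real (card W)"
proof -
  have "trace_inner all_ones_matrix (colouring_matrix E W y) =
          (\<Sum>S\<in>cocliques E W. y S * (\<Sum>v\<in>S. 1))"
    unfolding trace_inner_all_ones_eq_quadratic_form colouring_matrix_quadratic_form
    using coclique_card_pos by (intro sum.cong refl) (fastforce simp: power2_eq_square)
  then show ?thesis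
    by (simp only: fractional_colouring_weighted_sum[OF y]) simp
qed

section \<open>The bound\<close>

lemma card_le_theta:
  fixes E :: "'v::finite \<Rightarrow> 'v \<Rightarrow> bool"
  assumes irr: "irreflp E" and k: "0 \<le> k" "k \<le> real CARD('v)"
    and W: "fractional_chromatic_number E W \<le> k"
  shows "real (card W) \<le> theta E k"
proof -
  obtain y where y: "fractional_colouring E W y"
    and sum_y: "(\<Sum>S\<in>cocliques E W. y S) = fractional_chromatic_number E W"
    using fractional_chromatic_number_attained[OF irr] by blast
  obtain Y where "Y \<in> theta_feasible E k" "real (card W) \<le> trace_inner all_ones_matrix Y"
    using theta_feasible_raise_trace[OF irr colouring_matrix_feasible[OF y]] k W
    by (auto simp: sum_y colouring_matrix_objective[OF y])
  then show ?thesis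
    using theta_attained[OF irr k] by force
qed

lemma fractional_chromatic_number_singleton_le:
  fixes E :: "'v::finite \<Rightarrow> 'v \<Rightarrow> bool"
  assumes irr: "irreflp E"
  shows "fractional_chromatic_number E {v} \<le> 1"
proof -
  have C: "cocliques E {v} = {{v}}"
    using irr by (auto simp: cocliques_def irreflp_def)
  have "fractional_colouring E {v} (\<lambda>_. 1)"
    by (simp add: fractional_colouring_def C)
  then have "fractional_chromatic_number E {v} \<le> (\<Sum>S\<in>cocliques E {v}. 1)"
    using fractional_chromatic_number_attained[OF irr, of "{v}"] by blast
  then show ?thesis by (simp add: C)
qed

theorem theorem12:
  fixes E :: "'v::finite \<Rightarrow> 'v \<Rightarrow> bool" and k :: real
  assumes "simple_graph E" and "1 \<le> k" and "k \<le> real CARD('v)"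
  shows "real (alpha' E k) \<le> theta E k"
proof -
  let ?A = "{card W | W. W \<noteq> {} \<and> fractional_chromatic_number E W \<le> k}"
  have irr: "irreflp E"
    using assms(1) by (simp add: simple_graph_def)
  \<comment> \<open>A single vertex witnesses that the maximum is over a nonempty set; this uses \<open>1 \<le> k\<close>.\<close>
  have "fractional_chromatic_number E {undefined} \<le> k"
    using fractional_chromatic_number_singleton_le[OF irr, of undefined] assms(2) by linarith
  then have "?A \<noteq> {}" by blast
  moreover have "finite ?A" by simp
  ultimately have "alpha' E k \<in> ?A"
    unfolding alpha'_def by (rule Max_in[rotated])
  then show ?thesis
    using card_le_theta[OF irr _ assms(3)] assms(2) by auto
qed

end
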